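(* Let $k\ge 3$, and suppose that $1/\epsilon=O\left(\binom{d/3}{\lfloor (k-1)/2\rfloor}\right)$ and that the failure probability $\delta<1$ is a constant. Then for any $n\ge kd\log(d/k)/\epsilon$, the space complexity of any valid For-All-Itemset-Frequency-Indicator sketch satisfies $|\mathcal{S}(n,d,k,\epsilon,\delta)|=\Omega(kd\log(d/k)/\epsilon)$.
   Context: A database is $\mathcal{D}\in(\{0,1\}^d)^n$ ($n$ rows, $d$ binary columns). An itemset is $T\subseteq[d]$; a $k$-itemset has $|T|=k$. A row contains $T$ if it has a 1 in every column of $T$; $f_T(\mathcal{D})$ is the fraction of rows containing $T$. A For-All-Itemset-Frequency-Indicator sketch is a pair $(\mathcal{S},\mathcal{Q})$ where $\mathcal{S}$ is a randomized algorithm mapping $(\mathcal{D},k,\epsilon,\delta)$ to a bit string (summary) and $\mathcal{Q}$ is a deterministic procedure mapping a summary and a $k$-itemset $T$ to a bit, such that for every database $\mathcal{D}$, with probability at least $1-\delta$ over the randomness of $\mathcal{S}$, simultaneously for all $k$-itemsets $T$: if $f_T>\epsilon$ then $\mathcal{Q}$ outputs 1, and if $f_T<\epsilon/2$ then $\mathcal{Q}$ outputs 0. The space complexity $|\mathcal{S}(n,d,k,\epsilon,\delta)|$ is the maximum length in bits of the summary over all $\mathcal{D}\in(\{0,1\}^d)^n$.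
   Formalization: The bound is proved for all ε below a positive constant depending only on δ and the O-constant; without such a limit it fails (ε≥1: empty summary; k=3, ε=0.9: d bits suffice). Here d/3 is rounded down and log is the natural logarithm. *)

theory Defs
  imports "HOL-Probability.Probability"
begin

text \<open>A database with n rows and d binary columns: a list of n rows, each a bool list of
length d; column j of a row r is r ! j (columns indexed 0..d-1).\<close>
definition databases :: "nat \<Rightarrow> nat \<Rightarrow> bool list list set" where
  "databases n d = {D. length D = n \<and> (\<forall>r\<in>set D. length r = d)}"

definition itemsets :: "nat \<Rightarrow> nat \<Rightarrow> nat set set" where
  "itemsets d k = {T. T \<subseteq> {0..<d} \<and> card T = k}"

definition row_contains :: "bool list \<Rightarrow> nat set \<Rightarrow> bool" where
  "row_contains r T = (\<forall>j\<in>T. r ! j)"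

definition freq :: "nat set \<Rightarrow> bool list list \<Rightarrow> real" where
  "freq T D = real (length (filter (\<lambda>r. row_contains r T) D)) / real (length D)"

text \<open>For fixed parameters (n,d,k,eps,delta), a sketch is a randomized summary algorithm
S (database to a distribution over bit strings) and a deterministic query Q
(summary and itemset to a bit).\<close>
definition valid_FAIFI_sketch ::
  "nat \<Rightarrow> nat \<Rightarrow> nat \<Rightarrow> real \<Rightarrow> real \<Rightarrow>
   (bool list list \<Rightarrow> bool list pmf) \<Rightarrow> (bool list \<Rightarrow> nat set \<Rightarrow> bool) \<Rightarrow> bool" where
  "valid_FAIFI_sketch n d k eps delta S Q =
    (\<forall>D\<in>databases n d.
       measure_pmf.prob (S D)
         {s. \<forall>T\<in>itemsets d k. (freq T D > eps \<longrightarrow> Q s T) \<and> (freq T D < eps / 2 \<longrightarrow> \<not> Q s T)}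
       \<ge> 1 - delta)"

definition space_complexity :: "nat \<Rightarrow> nat \<Rightarrow> (bool list list \<Rightarrow> bool list pmf) \<Rightarrow> ereal" where
  "space_complexity n d S =
    (SUP D\<in>databases n d. SUP s\<in>set_pmf (S D). ereal (real (length s)))"

end

theory Submission
  imports Defs
begin

text \<open>
  A family of \<open>2 ^ P\<close> databases is built with \<open>P\<close> of order \<open>k d ln (d/k) / eps\<close>, one for each
  bit array indexed by a block \<open>b\<close>, a point \<open>p\<close> and a payload column \<open>j\<close>. There are about \<open>1 / eps\<close>
  blocks, told apart by itemsets of size \<open>(k - 1) div 2\<close>, and in each block about \<open>k ln (d/k)\<close>
  points, which itemsets of size about \<open>k / 2\<close> shatter. If one summary answers correctly for two
  arrays \<open>Y\<close> and \<open>Y'\<close>, then the query that selects, in block \<open>b\<close> and column \<open>j\<close>, exactly the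
  points of \<open>Y - Y'\<close> has frequency \<open>0\<close> for \<open>Y'\<close>, hence at most \<open>eps\<close> for \<open>Y\<close>; so \<open>Y\<close> and \<open>Y'\<close>
  differ in few cells. A Hamming ball of radius \<open>P / 16\<close> has at most \<open>2 powr (P / 2)\<close> elements, so
  averaging over the arrays shows that \<open>(1 - delta) * 2 powr (P / 2)\<close> summaries are needed.
\<close>

section \<open>Counting\<close>

text \<open>Weigh each \<open>Z\<close> by \<open>(1/4) ^ card Z\<close>. With
  \<open>P = card A\<close>, the total over \<open>Pow A\<close> is \<open>(5/4) ^ P\<close>, at
  most \<open>2 powr (3 * P / 8)\<close>, while every small \<open>Z\<close> weighs at least
  \<open>2 powr (- P / 8)\<close>.\<close>

lemma card_small_subsets_le:
  fixes A :: "'a set"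
  assumes "finite A"
  shows "real (card {Z. Z \<subseteq> A \<and> 16 * card Z \<le> card A}) \<le> 2 powr (card A / 2)"
proof -
  let ?P = "real (card A)"
  let ?F = "{Z. Z \<subseteq> A \<and> 16 * card Z \<le> card A}"
  have F: "?F \<subseteq> Pow A" by auto
  have fin: "finite (Pow A)" using assms by simp
  have weight: "2 powr (- ?P / 8) \<le> (1/4::real) ^ card Z" if "Z \<in> ?F" for Z
  proof -
    have "real (16 * card Z) \<le> ?P" using that by (simp only: of_nat_le_iff) auto
    then have "- ?P / 8 \<le> - 2 * real (card Z)" by simp
    then have "2 powr (- ?P / 8) \<le> (2::real) powr (- 2 * real (card Z))" by simp
    also have "\<dots> = (2 powr (-2)) powr real (card Z)" by (simp only: powr_powr)
    also have "\<dots> = (1/4) ^ card Z"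
      by (simp add: powr_realpow powr_minus powr_numeral field_simps)
    finally show ?thesis .
  qed
  have "real (card ?F) * 2 powr (- ?P / 8) \<le> (\<Sum>Z\<in>?F. (1/4) ^ card Z)"
    using sum_mono[of ?F "\<lambda>_. 2 powr (- ?P / 8)", OF weight] by simp
  also have "\<dots> \<le> (\<Sum>Z\<in>Pow A. (1/4) ^ card Z)"
    by (rule sum_mono2[OF fin F]) auto
  also have "\<dots> = (5/4) ^ card A"
    using prod_add[OF assms, of "\<lambda>_. 1/4::real" "\<lambda>_. 1"] by simp
  also have "\<dots> = (5/4) powr ?P" by (simp add: powr_realpow)
  also have "\<dots> \<le> (2 powr (3/8)) powr ?P"
  proof (rule powr_mono2)
    \<comment> \<open>It suffices that \<open>(5/4) ^ 8 \<le> 2 ^ 3\<close>, about 5.96 against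
      8.\<close>
    have "(5/4::real) = ((5/4) ^ 8) powr (1/8)"
      by (simp only: powr_realpow[symmetric] powr_powr) simp
    also have "\<dots> \<le> (2 ^ 3) powr (1/8)"
      by (rule powr_mono2) (auto simp: power_divide)
    also have "\<dots> = 2 powr (3/8)"
      by (simp only: powr_realpow[symmetric] powr_powr) simp
    finally show "(5/4::real) \<le> 2 powr (3/8)" .
  qed auto
  also have "\<dots> = 2 powr (?P / 2) * 2 powr (- ?P / 8)"
    by (simp only: powr_powr powr_add[symmetric]) (simp add: field_simps)
  finally show ?thesis by simp
qed

text \<open>Symmetric difference with a fixed member embeds the family into a Hamming ball.
  Closeness is one-sided but assumed in both orders, so the radius is twice
  \<open>card A / 32\<close>.\<close>

lemma card_close_family_le:
  fixes A :: "'a set"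
  assumes "finite A" and F: "F \<subseteq> Pow A"
    and close: "\<And>Y Y'. Y \<in> F \<Longrightarrow> Y' \<in> F \<Longrightarrow> 32 * card (Y - Y') \<le> card A"
  shows "real (card F) \<le> 2 powr (card A / 2)"
proof (cases "F = {}")
  case False
  then obtain Y0 where Y0: "Y0 \<in> F" by auto
  let ?g = "\<lambda>Y. (Y - Y0) \<union> (Y0 - Y)"
  let ?B = "{Z. Z \<subseteq> A \<and> 16 * card Z \<le> card A}"
  have inj: "inj_on ?g F" by (rule inj_onI) blast
  have "?g ` F \<subseteq> ?B"
  proof clarify
    fix Y assume Y: "Y \<in> F"
    have "card (?g Y) \<le> card (Y - Y0) + card (Y0 - Y)" by (rule card_Un_le)
    then have "16 * card (?g Y) \<le> card A" using close[OF Y Y0] close[OF Y0 Y] by linarith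
    then show "?g Y \<subseteq> A \<and> 16 * card (?g Y) \<le> card A" using Y Y0 F by blast
  qed
  moreover have "finite ?B" using assms(1) by simp
  ultimately have "card F \<le> card ?B" by (rule card_inj_on_le[OF inj])
  then show ?thesis using card_small_subsets_le[OF assms(1)] by linarith
qed simp

text \<open>Double counting of the pairs \<open>(x, w)\<close> with \<open>w \<in> G x\<close>.
  Point masses are at most 1, so success probability \<open>p\<close> forces at least
  \<open>p\<close> good summaries for each input.\<close>

lemma randomized_encoding_count:
  fixes S :: "'a \<Rightarrow> 'b pmf" and G :: "'a \<Rightarrow> 'b set"
  assumes "finite A" "finite W"
    and supp: "\<And>x. x \<in> A \<Longrightarrow> set_pmf (S x) \<subseteq> W"
    and good: "\<And>x. x \<in> A \<Longrightarrow> p \<le> measure_pmf.prob (S x) (G x)"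
    and few: "\<And>w. w \<in> W \<Longrightarrow> real (card {x \<in> A. w \<in> G x}) \<le> B"
  shows "p * real (card A) \<le> real (card W) * B"
proof -
  have "p * real (card A) = (\<Sum>x\<in>A. p)" by simp
  also have "\<dots> \<le> (\<Sum>x\<in>A. \<Sum>w\<in>W. if w \<in> G x then 1 else 0)"
  proof (rule sum_mono)
    fix x assume x: "x \<in> A"
    have "p \<le> measure_pmf.prob (S x) (G x)" by (rule good[OF x])
    also have "\<dots> = measure_pmf.prob (S x) (G x \<inter> set_pmf (S x))"
      by (rule measure_Int_set_pmf[symmetric])
    also have "\<dots> \<le> measure_pmf.prob (S x) (G x \<inter> W)"
      by (rule measure_pmf.finite_measure_mono) (use supp[OF x] in auto)
    also have "\<dots> = (\<Sum>w\<in>G x \<inter> W. pmf (S x) w)"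
      by (rule measure_measure_pmf_finite) (use assms(2) in auto)
    also have "\<dots> \<le> (\<Sum>w\<in>G x \<inter> W. 1)" by (rule sum_mono) (rule pmf_le_1)
    also have "\<dots> = (\<Sum>w\<in>W. if w \<in> G x then 1 else 0)"
      by (subst Int_commute) (rule sum.inter_restrict[OF assms(2)])
    finally show "p \<le> (\<Sum>w\<in>W. if w \<in> G x then 1 else 0)" .
  qed
  also have "\<dots> = (\<Sum>w\<in>W. \<Sum>x\<in>A. if w \<in> G x then 1 else 0)" by (rule sum.swap)
  also have "\<dots> = (\<Sum>w\<in>W. real (card {x \<in> A. w \<in> G x}))"
    by (rule sum.cong) (simp_all add: sum.inter_filter[OF assms(1), symmetric])
  also have "\<dots> \<le> real (card W) * B" using sum_bounded_above[of W, OF few] by simp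
  finally show ?thesis .
qed

lemma card_bool_lists_le: "card {s :: bool list. length s \<le> l} \<le> 2 ^ (l + 1)"
proof -
  have "card {s :: bool list. length s \<le> l} = (\<Sum>i\<le>l. 2 ^ i)"
    using card_lists_length_le[of "UNIV :: bool set" l] by simp
  also have "\<dots> < 2 ^ (l + 1)" by (induction l) auto
  finally show ?thesis by simp
qed

section \<open>Shattering rows by itemsets\<close>

text \<open>Shattering in the sense of VC dimension: the points are the column sets
  \<open>X p\<close>, the tests are containments of itemsets of size exactly \<open>k\<close>, so
  that queries of a prescribed size can be assembled.\<close>

definition shatters :: "'a set \<Rightarrow> nat \<Rightarrow> nat \<Rightarrow> (nat \<Rightarrow> 'a set) \<Rightarrow> bool" where
  "shatters U k v X \<longleftrightarrow>
    (\<forall>s\<subseteq>{..<v}. \<exists>T\<subseteq>U. card T = k \<and> (\<forall>p<v. T \<subseteq> X p \<longleftrightarrow> p \<in> s))"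

text \<open>Each point is completed by all columns of the other side, so the part of the itemset
  lying there imposes no condition on it.\<close>

lemma shatters_Un:
  assumes "finite U" "finite U'" and disj: "U \<inter> U' = {}"
    and X: "shatters U k v X" and X': "shatters U' k' v' X'"
  shows "shatters (U \<union> U') (k + k') (v + v')
    (\<lambda>p. if p < v then X p \<union> U' else X' (p - v) \<union> U)"
  unfolding shatters_def
proof (intro allI impI)
  fix s assume s: "s \<subseteq> {..<v + v'}"
  have "s \<inter> {..<v} \<subseteq> {..<v}" by simp
  then obtain T where T: "T \<subseteq> U" "card T = k" "\<forall>p<v. T \<subseteq> X p \<longleftrightarrow> p \<in> s"
    using X unfolding shatters_def by (metis Int_iff lessThan_iff)
  have "{p. v + p \<in> s} \<subseteq> {..<v'}" using s by auto
  then obtain T' where T': "T' \<subseteq> U'" "card T' = k'" "\<forall>p<v'. T' \<subseteq> X' p \<longleftrightarrow> v + p \<in> s"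
    using X' unfolding shatters_def by (metis mem_Collect_eq)
  have "T \<union> T' \<subseteq> (if p < v then X p \<union> U' else X' (p - v) \<union> U) \<longleftrightarrow> p \<in> s" if "p < v + v'" for p
  proof (cases "p < v")
    case True
    then have "T \<union> T' \<subseteq> X p \<union> U' \<longleftrightarrow> T \<subseteq> X p" using T(1) T'(1) disj by blast
    then show ?thesis using True T(3) by simp
  next
    case False
    then have "T \<union> T' \<subseteq> X' (p - v) \<union> U \<longleftrightarrow> T' \<subseteq> X' (p - v)" using T(1) T'(1) disj by blast
    moreover have "p - v < v'" "v + (p - v) = p" using that False by auto
    ultimately show ?thesis using False T'(3) by metis
  qed
  moreover have "card (T \<union> T') = k + k'"
    using T(1,2) T'(1,2) disj assms(1,2) by (subst card_Un_disjoint) (auto dest: finite_subset)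
  ultimately show "\<exists>T\<subseteq>U \<union> U'. card T = k + k' \<and>
      (\<forall>p<v + v'. T \<subseteq> (if p < v then X p \<union> U' else X' (p - v) \<union> U) \<longleftrightarrow> p \<in> s)"
    using T(1) T'(1) by (intro exI[of _ "T \<union> T'"]) auto
qed

text \<open>Index the \<open>2 ^ w\<close> columns by the subsets of the points and put the column
  of \<open>s\<close> into the points of \<open>s\<close>; that column alone then selects
  \<open>s\<close>.\<close>

lemma shatters_singletons:
  assumes "finite U" "card U = 2 ^ w"
  shows "\<exists>X. shatters U 1 w X"
proof -
  have "card (Pow {..<w}) = card U" using assms by (simp add: card_Pow)
  then obtain e where e: "bij_betw e (Pow {..<w}) U"
    using finite_same_card_bij[of "Pow {..<w}" U] assms(1) by auto
  let ?X = "\<lambda>p. e ` {s. s \<subseteq> {..<w} \<and> p \<in> s}"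
  have "shatters U 1 w ?X"
    unfolding shatters_def
  proof (intro allI impI)
    fix s assume s: "s \<subseteq> {..<w}"
    have inj: "inj_on e (Pow {..<w})" using e by (rule bij_betw_imp_inj_on)
    have "{e s} \<subseteq> ?X p \<longleftrightarrow> p \<in> s" for p using s inj by (auto dest: inj_onD)
    then show "\<exists>T\<subseteq>U. card T = 1 \<and> (\<forall>p<w. T \<subseteq> ?X p \<longleftrightarrow> p \<in> s)"
      using s e by (intro exI[of _ "{e s}"]) (auto simp: bij_betw_def)
  qed
  then show ?thesis by blast
qed

text \<open>Each of \<open>r\<close> disjoint groups of \<open>2 ^ w\<close> columns contributes one
  item and \<open>w\<close> points. The \<open>f\<close> filler items shatter nothing and only raise
  the itemset size.\<close>

lemma shatters_blocks:
  assumes "finite U" "r * 2 ^ w + f \<le> card U"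
  shows "\<exists>X. shatters U (r + f) (r * w) X"
  using assms
proof (induction r arbitrary: U)
  case 0
  then have "f \<le> card U" by simp
  then obtain T where "T \<subseteq> U" "card T = f" using obtain_subset_with_card_n by blast
  then show ?case by (auto simp: shatters_def)
next
  case (Suc r)
  then have "2 ^ w \<le> card U" by simp
  then obtain U1 where U1: "U1 \<subseteq> U" "card U1 = 2 ^ w" "finite U1"
    using obtain_subset_with_card_n by blast
  obtain X1 where X1: "shatters U1 1 w X1" using shatters_singletons U1 by blast
  have "card (U - U1) = card U - 2 ^ w" using U1 by (simp add: card_Diff_subset)
  then have "r * 2 ^ w + f \<le> card (U - U1)" using Suc.prems by simp
  then obtain X2 where X2: "shatters (U - U1) (r + f) (r * w) X2"
    using Suc.IH[of "U - U1"] Suc.prems(1) by auto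
  have "U1 \<union> (U - U1) = U" using U1(1) by auto
  then show ?case
    using shatters_Un[OF U1(3) _ _ X1 X2] Suc.prems(1) by (auto simp: add.assoc)
qed

section \<open>Tagged databases\<close>

text \<open>The row with index \<open>(b, p)\<close> carries the tag of block \<open>b\<close>, the shattered point \<open>p\<close> and the
  payload \<open>{j. (b, p, j) \<in> Y}\<close>. Since tags form an antichain, the itemset
  \<open>tag b \<union> T \<union> {j}\<close> counts those \<open>p\<close> in the block \<open>b\<close> that \<open>T\<close> selects and whose payload bit \<open>j\<close> is set.
  Every row is repeated \<open>q\<close> times, and all-zero rows pad the database to \<open>n\<close> rows.\<close>

locale tagged_database =
  fixes n d m k M v q :: nat and U\<^sub>0 U\<^sub>1 J :: "nat set" and tag X :: "nat \<Rightarrow> nat set"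
  assumes columns: "U\<^sub>0 \<union> U\<^sub>1 \<union> J \<subseteq> {0..<d}"
    and disjoint: "U\<^sub>0 \<inter> U\<^sub>1 = {}" "U\<^sub>0 \<inter> J = {}" "U\<^sub>1 \<inter> J = {}"
    and tag_inj: "inj_on tag {..<M}"
    and tag_itemset: "b < M \<Longrightarrow> tag b \<subseteq> U\<^sub>0 \<and> card (tag b) = m"
    and shattered: "shatters U\<^sub>1 k v X"
    and copies: "q * (M * v) \<le> n"
begin

definition cells :: "(nat \<times> nat \<times> nat) set" where
  "cells = {..<M} \<times> {..<v} \<times> J"

definition ones :: "(nat \<times> nat \<times> nat) set \<Rightarrow> nat \<times> nat \<Rightarrow> nat set" where
  "ones Y = (\<lambda>(b, p). tag b \<union> (X p \<inter> U\<^sub>1) \<union> {j \<in> J. (b, p, j) \<in> Y})"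

definition row :: "(nat \<times> nat \<times> nat) set \<Rightarrow> nat \<times> nat \<Rightarrow> bool list" where
  "row Y i = map (\<lambda>c. c \<in> ones Y i) [0..<d]"

definition db :: "(nat \<times> nat \<times> nat) set \<Rightarrow> bool list list" where
  "db Y = concat (replicate q (map (row Y) (List.product [0..<M] [0..<v])))
     @ replicate (n - q * (M * v)) (replicate d False)"

lemma finite_columns: "finite U\<^sub>0" "finite U\<^sub>1" "finite J"
  using columns by (auto intro: finite_subset[of _ "{0..<d}"])

lemma finite_cells: "finite cells"
  by (simp add: cells_def finite_columns)

lemma card_cells: "card cells = M * v * card J"
  by (simp add: cells_def card_cartesian_product)

lemma length_db: "length (db Y) = n"
  using copies by (simp add: db_def length_concat sum_list_replicate)

lemma db_in_databases: "db Y \<in> databases n d"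
  using length_db by (auto simp: databases_def db_def row_def)

lemma row_contains_row:
  assumes "T \<subseteq> {0..<d}"
  shows "row_contains (row Y i) T \<longleftrightarrow> T \<subseteq> ones Y i"
proof -
  have "row Y i ! j \<longleftrightarrow> j \<in> ones Y i" if "j \<in> T" for j
    using that assms by (auto simp: row_def)
  then show ?thesis by (auto simp: row_contains_def)
qed

lemma row_contains_query:
  assumes "b < M" "b' < M" "p < v" "T \<subseteq> U\<^sub>1" "j \<in> J"
  shows "row_contains (row Y (b', p)) (tag b \<union> T \<union> {j}) \<longleftrightarrow> b' = b \<and> T \<subseteq> X p \<and> (b, p, j) \<in> Y"
proof -
  note tags = tag_itemset[OF assms(1)] tag_itemset[OF assms(2)]
  have "tag b \<union> T \<union> {j} \<subseteq> {0..<d}" using tags columns assms by blast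
  then have "row_contains (row Y (b', p)) (tag b \<union> T \<union> {j}) \<longleftrightarrow>
      tag b \<union> T \<union> {j} \<subseteq> ones Y (b', p)"
    by (rule row_contains_row)
  also have "\<dots> \<longleftrightarrow> tag b \<subseteq> tag b' \<and> T \<subseteq> X p \<and> (b', p, j) \<in> Y"
    using tags disjoint assms(4,5) unfolding ones_def by blast
  \<comment> \<open>Tags have the same finite size, so inclusion forces equality, and injectivity
    identifies the blocks.\<close>
  also have "tag b \<subseteq> tag b' \<longleftrightarrow> b' = b"
    using tags tag_inj assms(1,2) finite_columns(1)
    by (metis card_subset_eq finite_subset inj_onD lessThan_iff order_refl)
  finally show ?thesis by auto
qed

lemma freq_query:
  assumes "b < M" "T \<subseteq> U\<^sub>1" "j \<in> J"
  shows "freq (tag b \<union> T \<union> {j}) (db Y) =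
    real q * real (card {p. p < v \<and> T \<subseteq> X p \<and> (b, p, j) \<in> Y}) / real n"
proof -
  let ?T = "tag b \<union> T \<union> {j}"
  let ?R = "List.product [0..<M] [0..<v]"
  \<comment> \<open>The payload column \<open>j\<close> keeps the itemset nonempty, so padding rows
    never count.\<close>
  have "j < d" using columns assms(3) by auto
  then have zero: "\<not> row_contains (replicate d False) ?T" by (auto simp: row_contains_def)
  have "length (filter (\<lambda>r. row_contains r ?T) (map (row Y) ?R)) =
      card ({i. row_contains (row Y i) ?T} \<inter> set ?R)"
    by (simp add: filter_map comp_def distinct_length_filter distinct_product)
  also have "{i. row_contains (row Y i) ?T} \<inter> set ?R =
      Pair b ` {p. p < v \<and> T \<subseteq> X p \<and> (b, p, j) \<in> Y}"
    using row_contains_query[OF assms(1) _ _ assms(2,3)] assms(1) by auto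
  also have "card \<dots> = card {p. p < v \<and> T \<subseteq> X p \<and> (b, p, j) \<in> Y}"
    by (rule card_image) (auto intro: inj_onI)
  finally show ?thesis
    using zero length_db
    by (simp add: freq_def db_def filter_concat length_concat sum_list_replicate)
qed

text \<open>For each block and payload column, the itemset selecting the fibre of
  \<open>Y - Y'\<close> has frequency 0 in \<open>db Y'\<close>, so \<open>Q\<close> rejects it and
  its frequency in \<open>db Y\<close> is at most \<open>eps\<close>. Copied rows fill at least half
  of the database, so the fibre has at most \<open>2 * eps * M * v\<close> points.\<close>

lemma common_summary_card_Diff:
  assumes "0 < eps" "0 < q" "n \<le> 2 * q * (M * v)" "Y \<subseteq> cells"
    and good: "\<forall>T\<in>itemsets d (m + k + 1).
        (freq T (db Y) > eps \<longrightarrow> Q T) \<and> (freq T (db Y) < eps / 2 \<longrightarrow> \<not> Q T)"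
    and good': "\<forall>T\<in>itemsets d (m + k + 1).
        (freq T (db Y') > eps \<longrightarrow> Q T) \<and> (freq T (db Y') < eps / 2 \<longrightarrow> \<not> Q T)"
  shows "real (card (Y - Y')) \<le> 2 * eps * real M * real (card cells)"
proof -
  let ?s = "\<lambda>b j. {p. p < v \<and> (b, p, j) \<in> Y - Y'}"
  have fibre: "real (card (?s b j)) \<le> 2 * eps * real (M * v)" if "b < M" "j \<in> J" for b j
  proof -
    have "?s b j \<subseteq> {..<v}" by auto
    then obtain T where T: "T \<subseteq> U\<^sub>1" "card T = k" "\<forall>p<v. T \<subseteq> X p \<longleftrightarrow> p \<in> ?s b j"
      using shattered unfolding shatters_def by meson
    let ?T = "tag b \<union> T \<union> {j}"
    note tag = tag_itemset[OF that(1)]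
    have fin: "finite (tag b)" "finite T"
      using tag T(1) finite_columns by (auto dest: finite_subset)
    have "tag b \<inter> T = {}" "j \<notin> tag b \<union> T" using tag T(1) that(2) disjoint by blast+
    then have "card ?T = m + k + 1" using fin tag T(2) by (simp add: card_Un_disjoint)
    then have item: "?T \<in> itemsets d (m + k + 1)"
      using columns tag T(1) that(2) unfolding itemsets_def by blast
    have "{p. p < v \<and> T \<subseteq> X p \<and> (b, p, j) \<in> Y'} = {}" using T(3) by auto
    then have "freq ?T (db Y') = 0" using freq_query[OF that(1) T(1) that(2)] by simp
    then have "\<not> Q ?T" using good' item assms(1) by auto
    then have "freq ?T (db Y) \<le> eps" using good item by (meson not_le)
    moreover have "{p. p < v \<and> T \<subseteq> X p \<and> (b, p, j) \<in> Y} = ?s b j" using T(3) by auto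
    ultimately have "real q * real (card (?s b j)) / real n \<le> eps"
      using freq_query[OF that(1) T(1) that(2), of Y] by simp
    \<comment> \<open>Division by 0 yields 0, so \<open>n = 0\<close> is treated apart: then
      \<open>v = 0\<close> and the fibre is empty.\<close>
    moreover have "card (?s b j) = 0 \<or> 0 < n"
    proof (cases "v = 0")
      case False
      then have "0 < q * (M * v)" using that(1) assms(2) by simp
      then show ?thesis using copies by linarith
    qed simp
    ultimately have "real q * real (card (?s b j)) \<le> eps * real n"
    proof (elim disjE)
      assume "card (?s b j) = 0"
      then show ?thesis using assms(1) by (simp only: of_nat_0) simp
    qed (simp add: pos_divide_le_eq)
    also have "\<dots> \<le> eps * real (2 * q * (M * v))"
      using assms(1,3) by (intro mult_left_mono) (simp_all only: of_nat_le_iff less_imp_le)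
    finally have "real q * real (card (?s b j)) \<le> real q * (2 * eps * real (M * v))"
      by (simp add: algebra_simps)
    then show ?thesis using assms(2) by simp
  qed
  let ?I = "{..<M} \<times> J"
  have finI: "finite ?I" by (simp add: finite_columns)
  have "Y - Y' = (\<Union>i\<in>?I. (\<lambda>p. (fst i, p, snd i)) ` ?s (fst i) (snd i))"
    (is "_ = \<Union> (?B ` ?I)")
    using assms(4) by (force simp: cells_def)
  then have "card (Y - Y') \<le> (\<Sum>i\<in>?I. card (?B i))"
    using card_UN_le[OF finI, of ?B] by (simp only:)
  also have "\<dots> \<le> (\<Sum>i\<in>?I. card (?s (fst i) (snd i)))"
    by (intro sum_mono card_image_le) simp
  finally have "real (card (Y - Y')) \<le> real (\<Sum>i\<in>?I. card (?s (fst i) (snd i)))"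
    by (rule of_nat_mono)
  also have "\<dots> = (\<Sum>i\<in>?I. real (card (?s (fst i) (snd i))))" by (rule of_nat_sum)
  also have "\<dots> \<le> (\<Sum>i\<in>?I. 2 * eps * real (M * v))"
    using fibre by (intro sum_mono) auto
  also have "\<dots> = 2 * eps * real M * real (card cells)"
    by (simp add: card_cells card_cartesian_product algebra_simps)
  finally show ?thesis .
qed

text \<open>The bound \<open>64 * eps * M \<le> 1\<close> makes the one-sided difference of arrays
  with a common correct summary at most a 1/32 fraction of the cells. With
  \<open>P = card cells\<close>, one summary thus serves at most \<open>2 powr (P / 2)\<close> of
  the \<open>2 ^ P\<close> arrays.\<close>

lemma summary_length_lower_bound:
  fixes eps delta :: real and l :: nat
  assumes "0 < eps" "0 < q" "n \<le> 2 * q * (M * v)" "64 * eps * real M \<le> 1"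
    and valid: "valid_FAIFI_sketch n d (m + k + 1) eps delta S Q"
    and len: "\<And>D s. D \<in> databases n d \<Longrightarrow> s \<in> set_pmf (S D) \<Longrightarrow> length s \<le> l"
  shows "(1 - delta) * 2 powr (card cells / 2) \<le> 2 ^ (l + 1)"
proof -
  let ?K = "itemsets d (m + k + 1)"
  let ?G = "\<lambda>Y. {s. \<forall>T\<in>?K. (freq T (db Y) > eps \<longrightarrow> Q s T) \<and>
    (freq T (db Y) < eps / 2 \<longrightarrow> \<not> Q s T)}"
  let ?W = "{s :: bool list. length s \<le> l}"
  have finW: "finite ?W" using finite_lists_length_le[of "UNIV :: bool set" l] by simp
  have "(1 - delta) * real (card (Pow cells)) \<le> real (card ?W) * 2 powr (card cells / 2)"
  proof (rule randomized_encoding_count[where S = "\<lambda>Y. S (db Y)" and G = ?G])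
    show "finite (Pow cells)" by (simp add: finite_cells)
    show "finite ?W" by (rule finW)
    show "set_pmf (S (db Y)) \<subseteq> ?W" for Y using len[OF db_in_databases] by auto
    show "1 - delta \<le> measure_pmf.prob (S (db Y)) (?G Y)" for Y
      using valid db_in_databases unfolding valid_FAIFI_sketch_def by blast
    show "real (card {Y \<in> Pow cells. s \<in> ?G Y}) \<le> 2 powr (card cells / 2)" for s
    proof (rule card_close_family_le[OF finite_cells])
      fix Y Y' assume Y: "Y \<in> {Y \<in> Pow cells. s \<in> ?G Y}" and Y': "Y' \<in> {Y \<in> Pow cells. s \<in> ?G Y}"
      have "real (card (Y - Y')) \<le> 2 * eps * real M * real (card cells)"
        by (rule common_summary_card_Diff[where Q = "Q s"]) (use Y Y' assms(1-3) in auto)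
      moreover have "64 * eps * real M * real (card cells) \<le> real (card cells)"
        using mult_right_mono[OF assms(4), of "real (card cells)"] by simp
      ultimately have "real (32 * card (Y - Y')) \<le> real (card cells)" by simp
      then show "32 * card (Y - Y') \<le> card cells" by (simp only: of_nat_le_iff)
    qed auto
  qed
  also have "real (card (Pow cells)) = 2 powr (card cells / 2) * 2 powr (card cells / 2)"
    by (simp add: card_Pow finite_cells powr_add[symmetric] powr_realpow)
  finally have "(1 - delta) * 2 powr (card cells / 2) \<le> real (card ?W)" by simp
  also have "\<dots> \<le> real (2 ^ (l + 1))" by (rule of_nat_mono) (rule card_bool_lists_le)
  finally show ?thesis by simp
qed

end

section \<open>Choice of parameters\<close>

lemma injective_itemset_family:
  assumes "finite U" "M \<le> card U choose m"
  obtains tag :: "nat \<Rightarrow> 'a set"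
  where "inj_on tag {..<M}" "\<And>b. b < M \<Longrightarrow> tag b \<subseteq> U \<and> card (tag b) = m"
proof -
  let ?B = "{B. B \<subseteq> U \<and> card B = m}"
  have "card {..<M} \<le> card ?B" using assms by (simp add: n_subsets)
  moreover have "finite ?B" using assms(1) by simp
  ultimately obtain tag where "tag ` {..<M} \<subseteq> ?B" "inj_on tag {..<M}"
    using card_le_inj[of "{..<M}" ?B] by auto
  then show thesis by (intro that) auto
qed

text \<open>Only \<open>a div 2\<close> columns are given to the payload and only about half of the \<open>k'\<close> shattering
  items to blocks of \<open>2 ^ w\<close> columns, the others being fillers: this keeps \<open>w \<ge> 1\<close> even when
  \<open>d\<close> is as small as \<open>3 * k / 2\<close>.\<close>

lemma shattering_width:
  fixes k d :: nat
  defines "a \<equiv> d div 3" and "m \<equiv> (k - 1) div 2"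
  defines "k' \<equiv> k - 1 - m" and "r \<equiv> (k - m) div 2"
  assumes "3 \<le> k" "m < a"
  obtains w where "r * 2 ^ w + (k' - r) \<le> d - a - a div 2" "1 \<le> w" "w \<le> d" "d \<le> 10 * k * 2 ^ w"
proof -
  define h where "h = a div 2"
  \<comment> \<open>The slack in the shattering part after reserving one column for each of its
    \<open>k'\<close> items.\<close>
  define F where "F = d - a - h - k'"
  have r: "0 < r" "r \<le> k'" "2 * r \<le> k" using assms(5) unfolding r_def k'_def m_def by auto
  have h: "2 * h \<le> a" "a \<le> 2 * h + 1" unfolding h_def by linarith+
  have k'_le: "k' \<le> a" "2 * r \<le> a + 1"
    using assms(5,6) unfolding k'_def m_def r_def by linarith+
  have cols: "3 * a \<le> d" "d \<le> 5 * a" "0 < a"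
    using assms(6) unfolding a_def by linarith+
  have "h + a + k' \<le> d" using h(1) cols(1) k'_le(1) by linarith
  then have Fk: "F + k' + a + h = d" unfolding F_def by simp
  then have F: "a \<le> F + h" "a \<le> 2 * F" "r \<le> F" "F < d"
    using h cols k'_le by linarith+
  \<comment> \<open>The largest \<open>w\<close> with \<open>2 ^ w \<le> F div r + 1\<close>: this
    keeps the blocks within the slack, and maximality bounds \<open>d\<close> by
    \<open>10 * k * 2 ^ w\<close>.\<close>
  obtain w where w: "2 ^ w \<le> F div r + 1" "F div r + 1 < 2 ^ (w + 1)"
    using ex_power_ivl1[of 2 "F div r + 1"] by auto
  have "1 \<le> F div r" using r F(3) by (simp add: Suc_le_eq div_greater_zero_iff)
  then have "w \<noteq> 0" using w(2) by (intro notI) simp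
  have "r * 2 ^ w \<le> r * (F div r + 1)" using w(1) by (rule mult_le_mono2)
  also have "\<dots> \<le> F + r" by (simp add: algebra_simps)
  finally have 1: "r * 2 ^ w + (k' - r) \<le> d - a - a div 2"
    using Fk r(2) unfolding h_def[symmetric] by linarith
  have "w < 2 ^ w" by (rule less_exp)
  also have "\<dots> \<le> F + 1" using w(1) div_le_dividend[of F r] by linarith
  finally have 3: "w \<le> d" using F(4) by linarith
  have "F < r * (F div r + 1)"
    using r(1) by (simp add: algebra_simps dividend_less_times_div)
  also have "\<dots> \<le> r * 2 ^ (w + 1)" using w(2) by (intro mult_le_mono2) simp
  finally have "10 * F \<le> 10 * (2 * r) * 2 ^ w" by simp
  also have "\<dots> \<le> 10 * k * 2 ^ w" using r(3) by (intro mult_le_mono1) simp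
  finally have 4: "d \<le> 10 * k * 2 ^ w" using F(2) cols(2) by linarith
  show thesis using that[OF 1 _ 3 4] \<open>w \<noteq> 0\<close> by simp
qed

text \<open>Makes the block exponent \<open>w\<close> at least of order \<open>ln (d / k)\<close>.
  Since \<open>w \<ge> 1\<close>, the factor 10 is absorbed by \<open>16 ^ w\<close>, leaving
  \<open>2 ^ (5 * w)\<close>.\<close>

lemma ln_le_of_le_exp2:
  fixes x :: real
  assumes "0 < x" "x \<le> 10 * 2 ^ w" "1 \<le> w"
  shows "ln x \<le> 5 * real w"
proof -
  have "(10::real) \<le> 16 ^ 1" by simp
  also have "\<dots> \<le> 16 ^ w" using assms(3) by (intro power_increasing) auto
  finally have "10 * 2 ^ w \<le> (16::real) ^ w * 2 ^ w" by (intro mult_right_mono) auto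
  also have "\<dots> = 2 ^ (5 * w)" by (simp add: power_mult_distrib[symmetric] power_mult)
  finally have "ln x \<le> ln (2 ^ (5 * w))" using assms(1,2) by (subst ln_le_cancel_iff) auto
  also have "\<dots> = 5 * real w * ln 2" by (simp add: ln_realpow)
  also have "\<dots> \<le> 5 * real w * 1"
    using ln_le_minus_one[of "2::real"] by (intro mult_left_mono) auto
  finally show ?thesis by simp
qed

text \<open>A third of the columns carries tags, half as many carry payload, the rest is for
  shattering. The bound \<open>M \<le> P\<close> makes \<open>P\<close> large for small
  \<open>eps\<close>; 450 is \<open>6 * 15 * 5\<close>, from \<open>k \<le> 6 * r\<close>,
  \<open>d \<le> 15 * (a div 2)\<close> and \<open>ln (d / k) \<le> 5 * w\<close>.\<close>

lemma summary_lengths_determine_cells: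
  fixes eps delta :: real
  assumes k: "3 \<le> k" and m: "(k - 1) div 2 < d div 3"
    and M: "0 < M" "M \<le> (d div 3) choose ((k - 1) div 2)" "64 * eps * real M \<le> 1"
    and n: "M * (k * d) \<le> n" and "0 < eps"
    and valid: "valid_FAIFI_sketch n d k eps delta S Q"
    and len: "\<And>D s. D \<in> databases n d \<Longrightarrow> s \<in> set_pmf (S D) \<Longrightarrow> length s \<le> l"
  shows "\<exists>P. (1 - delta) * 2 powr (real P / 2) \<le> 2 ^ (l + 1) \<and> M \<le> P \<and>
    real M * real k * real d * ln (real d / real k) \<le> 450 * real P"
proof -
  define a where "a = d div 3"
  define m where "m = (k - 1) div 2"
  define k' where "k' = k - 1 - m"
  define r where "r = (k - m) div 2"
  have ma: "m < a" using m unfolding a_def m_def .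
  obtain w where w: "r * 2 ^ w + (k' - r) \<le> d - a - a div 2" "1 \<le> w" "w \<le> d" "d \<le> 10 * k * 2 ^ w"
    using shattering_width[OF k m] unfolding a_def m_def k'_def r_def by blast
  have r: "1 \<le> r" "r \<le> k'" "r \<le> k" "k \<le> 6 * r" "m + k' + 1 = k"
    using k unfolding r_def k'_def m_def by linarith+
  have J: "1 \<le> a div 2" "d \<le> 15 * (a div 2)" "a + a div 2 \<le> d"
  proof -
    have "2 \<le> a" using ma k unfolding m_def by linarith
    then show "1 \<le> a div 2" by linarith
    then have "a \<le> 3 * (a div 2)" by linarith
    moreover have "d \<le> 5 * a" "3 * a \<le> d" using \<open>2 \<le> a\<close> unfolding a_def by linarith+
    ultimately show "d \<le> 15 * (a div 2)" "a + a div 2 \<le> d" by linarith+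
  qed
  let ?U0 = "{0..<a}" and ?J = "{a..<a + a div 2}" and ?U1 = "{a + a div 2..<d}"
  have "r * 2 ^ w + (k' - r) \<le> card ?U1" using w(1) by simp
  then obtain X where X: "shatters ?U1 (r + (k' - r)) (r * w) X"
    using shatters_blocks[of ?U1] by blast
  obtain tag where tag: "inj_on tag {..<M}" "\<And>b. b < M \<Longrightarrow> tag b \<subseteq> ?U0 \<and> card (tag b) = m"
    using injective_itemset_family[of ?U0 M m] M(2) unfolding a_def m_def by auto
  let ?v = "r * w"
  \<comment> \<open>As many whole copies as fit; since \<open>q \<ge> 1\<close>, padding takes less
    than half of the rows.\<close>
  define q where "q = n div (M * ?v)"
  have v: "1 \<le> ?v" using r(1) w(2) by simp
  have "M * ?v \<le> M * (k * d)" using r(3) w(3) by (intro mult_le_mono) auto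
  then have Nn: "M * ?v \<le> n" using n by linarith
  have N0: "0 < M * ?v" using M(1) v by simp
  interpret tagged_database n d m k' M ?v q ?U0 ?U1 ?J tag X
  proof
    show "?U0 \<union> ?U1 \<union> ?J \<subseteq> {0..<d}" using J by auto
    show "shatters ?U1 k' ?v X" using X r(2) by simp
    show "q * (M * ?v) \<le> n" unfolding q_def by simp
  qed (use tag in auto)
  have q: "0 < q" using Nn N0 by (simp add: q_def div_greater_zero_iff)
  have "n < M * ?v * q + M * ?v"
    using dividend_less_times_div[OF N0, of n] by (simp add: q_def)
  also have "\<dots> \<le> 2 * q * (M * ?v)" using mult_le_mono1[of 1 q "M * ?v"] q by simp
  finally have "(1 - delta) * 2 powr (real (card cells) / 2) \<le> 2 ^ (l + 1)"
    using summary_length_lower_bound[OF \<open>0 < eps\<close> q _ M(3) _ len] valid r(5) by simp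
  moreover have P: "card cells = M * ?v * (a div 2)" by (simp add: card_cells)
  have "M * 1 * 1 \<le> M * ?v * (a div 2)" using v J(1) by (intro mult_le_mono) auto
  then have "M \<le> card cells" using P by simp
  moreover have "real M * real k * real d * ln (real d / real k) \<le> 450 * real (card cells)"
  proof -
    have d0: "0 < d" using J by linarith
    have "real d \<le> real (10 * k * 2 ^ w)" using w(4) by (rule of_nat_mono)
    then have "real d / real k \<le> 10 * 2 ^ w" using k by (simp add: field_simps)
    then have ln: "ln (real d / real k) \<le> 5 * real w"
      using d0 k w(2) by (intro ln_le_of_le_exp2) auto
    have "k \<le> d" using ma k unfolding a_def m_def by linarith
    then have ln_ge: "0 \<le> ln (real d / real k)" using k by (intro ln_ge_zero) simp
    have "real k \<le> 6 * real r" "real d \<le> 15 * real (a div 2)" using r(4) J(2) by linarith+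
    then have kd: "real k * real d \<le> (6 * real r) * (15 * real (a div 2))"
      by (intro mult_mono) auto
    have "real M * (real k * real d) * ln (real d / real k)
        \<le> real M * ((6 * real r) * (15 * real (a div 2))) * (5 * real w)"
      by (intro mult_mono[OF mult_left_mono[OF kd] ln]) (use ln_ge in auto)
    then show ?thesis by (simp add: P algebra_simps)
  qed
  ultimately show ?thesis by blast
qed

text \<open>The exponents \<open>P / 2\<close> and \<open>P / 8 + 1\<close> differ by
  \<open>?y\<close>, which is at least \<open>2 / e\<close>; then \<open>exp z \<ge> 1 + z\<close>
  and \<open>ln 2 \<ge> 2/3\<close> give \<open>2 powr ?y > 1 / e\<close>.\<close>

lemma exponential_gap:
  fixes e :: real
  assumes "0 < e" "e \<le> 1" "8 / e \<le> real P" "real l \<le> real P / 8"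
  shows "2 ^ (l + 1) < e * 2 powr (real P / 2)"
proof -
  let ?y = "3 * real P / 8 - 1"
  have "1 \<le> 1 / e" using assms(1,2) by simp
  then have y: "2 / e \<le> ?y" using assms(3) by (simp add: field_simps)
  have "(2/e) * (2/3) \<le> ?y * ln 2"
  proof (rule mult_mono)
    have "0 \<le> 2 / e" using assms(1) by simp
    then show "0 \<le> ?y" using y by linarith
  qed (use y ln2_ge_two_thirds in auto)
  then have "1 / e < 1 + ?y * ln 2" using assms(1) by (simp add: field_simps)
  also have "\<dots> \<le> exp (?y * ln 2)" by (rule exp_ge_add_one_self)
  also have "\<dots> = 2 powr ?y" by (simp add: powr_def)
  finally have gap: "1 < e * 2 powr ?y" using assms(1) by (simp add: field_simps)
  have "(2::real) ^ (l + 1) = 2 powr (real l + 1)" by (simp add: powr_add powr_realpow)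
  also have "\<dots> \<le> 2 powr (real P / 8 + 1)" using assms(4) by simp
  also have "\<dots> < 2 powr (real P / 8 + 1) * (e * 2 powr ?y)" using gap by simp
  also have "\<dots> = e * (2 powr (real P / 8 + 1) * 2 powr ?y)" by simp
  also have "2 powr (real P / 8 + 1) * 2 powr ?y = 2 powr (real P / 2)"
    by (simp only: powr_add[symmetric]) (simp add: field_simps)
  finally show ?thesis .
qed

text \<open>\<open>c0\<close> is the constant hidden in the O and \<open>c\<close> the one in the
  Omega. Both \<open>c\<close> and \<open>eps0\<close> are fixed before \<open>k\<close>,
  \<open>d\<close>, \<open>eps\<close> and \<open>n\<close>, so the bound is uniform for small
  \<open>eps\<close>.\<close>

theorem theorem4:
  fixes c0 :: real and delta :: real
  assumes "c0 > 0" and "0 \<le> delta" and "delta < 1"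
  shows "\<exists>c>0. \<exists>eps0>0. \<forall>(k::nat) (d::nat) (eps::real) (n::nat) S Q.
     k \<ge> 3 \<and> 0 < eps \<and> eps \<le> eps0 \<and>
     1 / eps \<le> c0 * real ((d div 3) choose ((k - 1) div 2)) \<and>
     real n \<ge> real k * real d * ln (real d / real k) / eps \<and>
     valid_FAIFI_sketch n d k eps delta S Q
     \<longrightarrow> space_complexity n d S \<ge> ereal (c * real k * real d * ln (real d / real k) / eps)"
proof -
  \<comment> \<open>About \<open>1 / (C * eps)\<close> blocks are used: \<open>C \<ge> 64\<close>
    gives \<open>64 * eps * M \<le> 1\<close>, and \<open>C \<ge> c0\<close> leaves enough tags. The
    choice of \<open>eps0\<close> yields \<open>P \<ge> M \<ge> 8 / (1 - delta)\<close>. The factor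
    7200 is \<open>2 * 450 * 8\<close>: rounding of \<open>M\<close>, cell count, and length
    \<open>P / 8\<close>.\<close>
  define C where "C = max 64 c0"
  define eps0 where "eps0 = (1 - delta) / (16 * C)"
  define c where "c = 1 / (7200 * C)"
  have C: "64 \<le> C" "c0 \<le> C" "0 < C" unfolding C_def by auto
  have eps0: "0 < eps0" using C assms by (simp add: eps0_def)
  have c: "0 < c" using C by (simp add: c_def)
  have main: "ereal (c * real k * real d * ln (real d / real k) / eps) \<le> space_complexity n d S"
    if k: "3 \<le> k" and eps: "0 < eps" "eps \<le> eps0"
      and ch: "1 / eps \<le> c0 * real ((d div 3) choose ((k - 1) div 2))"
      and n: "real k * real d * ln (real d / real k) / eps \<le> real n"
      and valid: "valid_FAIFI_sketch n d k eps delta S Q"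
    for k d n :: nat and eps S Q
  proof (rule ccontr)
    let ?ch = "(d div 3) choose ((k - 1) div 2)"
    let ?L = "c * real k * real d * ln (real d / real k) / eps"
    let ?l = "nat \<lfloor>?L\<rfloor>"
    define M where "M = nat \<lfloor>1 / (C * eps)\<rfloor>"
    assume "\<not> ereal ?L \<le> space_complexity n d S"
    then have sc: "space_complexity n d S < ereal ?L" by simp
    have inv: "16 / (1 - delta) \<le> 1 / (C * eps)"
      using eps C assms(3) by (simp add: eps0_def field_simps)
    have "16 \<le> 16 / (1 - delta)" using assms(2,3) by (simp add: field_simps)
    with inv have inv16: "16 \<le> 1 / (C * eps)" by linarith
    have M_le: "real M \<le> 1 / (C * eps)" using C eps by (simp add: M_def)
    have M_ge: "1 / (2 * C * eps) \<le> real M"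
    proof -
      have "1 / (C * eps) - 1 \<le> real M" unfolding M_def by linarith
      moreover have "1 / (2 * C * eps) = 1 / (C * eps) / 2" by simp
      ultimately show ?thesis using inv16 by linarith
    qed
    have "1 / (C * eps) = (1 / eps) / C" using C eps by (simp add: field_simps)
    also have "\<dots> \<le> c0 * real ?ch / C" using ch C by (intro divide_right_mono) auto
    also have "\<dots> \<le> real ?ch" using C by (simp add: field_simps mult_right_mono)
    finally have ch_ge: "1 / (C * eps) \<le> real ?ch" .
    \<comment> \<open>Otherwise the binomial coefficient is at most 1, whereas it is at least
      16.\<close>
    have m: "(k - 1) div 2 < d div 3"
    proof (rule ccontr)
      assume "\<not> (k - 1) div 2 < d div 3"
      then have "?ch \<le> 1" by (cases "(k - 1) div 2 = d div 3") (auto simp: binomial_eq_0)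
      then show False using ch_ge inv16 by linarith
    qed
    have M: "0 < M" "M \<le> ?ch" "64 * eps * real M \<le> 1"
    proof -
      show "0 < M" using inv16 by (simp add: M_def)
      show "M \<le> ?ch" using M_le ch_ge by linarith
      have "64 * eps * real M \<le> C * eps * (1 / (C * eps))"
        using C eps M_le by (intro mult_mono) auto
      then show "64 * eps * real M \<le> 1" using C eps by simp
    qed
    \<comment> \<open>Keeps \<open>d / k\<close> away from 1, so the logarithm is at least 1/3; this
      turns the hypothesis on \<open>n\<close> into \<open>M * (k * d) \<le> n\<close>.\<close>
    have "3 * k \<le> 2 * d" using m k by linarith
    then have "3 / 2 \<le> real d / real k" using k by (simp add: field_simps)
    then have "ln (3 / 2) \<le> ln (real d / real k)" by (intro ln_mono) auto
    moreover have "(1::real) / 3 \<le> ln (3 / 2)"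
      using ln_le_minus_one[of "2/3::real"] ln_inverse[of "3/2::real"] by simp
    ultimately have ln: "1 / 3 \<le> ln (real d / real k)" by linarith
    have "real (M * (k * d)) = real (k * d) * real M" by simp
    also have "\<dots> \<le> real (k * d) * (1 / (C * eps))" using M_le by (intro mult_left_mono) auto
    also have "\<dots> \<le> real (k * d) * (ln (real d / real k) / eps)"
    proof (rule mult_left_mono)
      have "1 / C \<le> 1 / 3" using C by simp
      then have "1 / C \<le> ln (real d / real k)" using ln by linarith
      then show "1 / (C * eps) \<le> ln (real d / real k) / eps"
        using divide_right_mono[of "1 / C" _ eps] eps by simp
    qed simp
    also have "\<dots> \<le> real n" using n by simp
    finally have n': "M * (k * d) \<le> n" by (simp only: of_nat_le_iff)
    have len: "length s \<le> ?l" if "D \<in> databases n d" "s \<in> set_pmf (S D)" for D s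
    proof -
      have "ereal (real (length s)) \<le> space_complexity n d S"
        unfolding space_complexity_def using that by (meson SUP_upper2 SUP_upper)
      then have "ereal (real (length s)) < ereal ?L" using sc by (rule le_less_trans)
      then have "real (length s) < ?L" by simp
      then show ?thesis by linarith
    qed
    obtain P where P: "(1 - delta) * 2 powr (real P / 2) \<le> 2 ^ (?l + 1)" "M \<le> P"
        "real M * real k * real d * ln (real d / real k) \<le> 450 * real P"
      using summary_lengths_determine_cells[OF k m M n' eps(1) valid, of ?l] len by blast
    let ?x = "real k * real d * ln (real d / real k)"
    have x: "0 \<le> ?x" using ln by simp
    have "?L = (1 / (2 * C * eps)) * ?x / 3600" by (simp add: c_def)
    also have "\<dots> \<le> real M * ?x / 3600"
      using M_ge x by (intro divide_right_mono mult_right_mono) auto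
    also have "\<dots> \<le> real P / 8" using P(3) by (simp add: algebra_simps)
    finally have L: "?L \<le> real P / 8" .
    have "0 \<le> ?L" using ln c eps by simp
    then have "real ?l \<le> ?L" by simp
    then have "real ?l \<le> real P / 8" using L by linarith
    moreover have "8 / (1 - delta) \<le> real P"
    proof -
      have "8 / (1 - delta) = 16 / (1 - delta) / 2" using assms(3) by (simp add: field_simps)
      also have "\<dots> \<le> 1 / (C * eps) / 2" using inv by (rule divide_right_mono) simp
      also have "\<dots> = 1 / (2 * C * eps)" by simp
      finally show ?thesis using M_ge P(2) by linarith
    qed
    ultimately have "2 ^ (?l + 1) < (1 - delta) * 2 powr (real P / 2)"
      using assms(2,3) by (intro exponential_gap) auto
    then show False using P(1) by linarith
  qed
  show ?thesis
    using c eps0 main by (intro exI[of _ c] conjI exI[of _ eps0]) auto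
qed

end
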